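(* Let $f\in{\cal N}_1$ have divisor $D=((a_n),(b_n))$ and let $\delta>0$. Then there are constants $C_\delta,C'_\delta<\infty$ such that $|f(z)|\le C_\delta$ for all $z\notin\bigcup_nB(b_n,\delta)$, $|f(z)|\ge1/C_\delta$ for all $z\notin\bigcup_nB(a_n,\delta)$, and $|f'(z)/f(z)|\le C'_\delta$ for all $z\notin\bigcup_nB(a_n,\delta)\cup\bigcup_nB(b_n,\delta)$.
   Context: $\rho_S$ is the spherical metric. A meromorphic $f$ on $\mathbb{C}$ is normal if every sequence of translates $f(z+h_n)$ has a subsequence Cauchy in $\rho_S$ uniformly on compacta; $f\in{\cal N}_1$ if moreover no such limit of translates is a constant function (including $\infty$). The divisor lists zeros $a_n$ and poles $b_n$ of $f$ with multiplicity. *)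

theory Defs
  imports "HOL-Analysis.Analysis"
begin

definition pole_set :: "(complex \<Rightarrow> complex) \<Rightarrow> complex set" where
  "pole_set f = {z. filterlim f at_infinity (at z)}"

definition meromorphic_C :: "(complex \<Rightarrow> complex) \<Rightarrow> bool" where
  "meromorphic_C f \<longleftrightarrow> (\<forall>z. \<not> z islimpt pole_set f) \<and> f holomorphic_on (- pole_set f)"

definition zero_set :: "(complex \<Rightarrow> complex) \<Rightarrow> complex set" where
  "zero_set f = {z. z \<notin> pole_set f \<and> f z = 0}"

text \<open>Values on the Riemann sphere: None stands for infinity.\<close>
definition sphere_val :: "(complex \<Rightarrow> complex) \<Rightarrow> complex \<Rightarrow> complex option" where
  "sphere_val f z = (if z \<in> pole_set f then None else Some (f z))"

fun chordal :: "complex option \<Rightarrow> complex option \<Rightarrow> real" where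
  "chordal None None = 0"
| "chordal (Some w) None = 2 / sqrt (1 + (cmod w)\<^sup>2)"
| "chordal None (Some w) = 2 / sqrt (1 + (cmod w)\<^sup>2)"
| "chordal (Some v) (Some w) =
     2 * cmod (v - w) / sqrt ((1 + (cmod v)\<^sup>2) * (1 + (cmod w)\<^sup>2))"

definition unif_cauchy_compacta :: "(nat \<Rightarrow> complex \<Rightarrow> complex option) \<Rightarrow> bool" where
  "unif_cauchy_compacta F \<longleftrightarrow>
     (\<forall>K. compact K \<longrightarrow> (\<forall>e>0. \<exists>N. \<forall>m\<ge>N. \<forall>n\<ge>N. \<forall>z\<in>K. chordal (F m z) (F n z) < e))"

definition unif_conv_compacta ::
    "(nat \<Rightarrow> complex \<Rightarrow> complex option) \<Rightarrow> (complex \<Rightarrow> complex option) \<Rightarrow> bool" where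
  "unif_conv_compacta F g \<longleftrightarrow>
     (\<forall>K. compact K \<longrightarrow> (\<forall>e>0. \<exists>N. \<forall>n\<ge>N. \<forall>z\<in>K. chordal (F n z) (g z) < e))"

definition normal_fun :: "(complex \<Rightarrow> complex) \<Rightarrow> bool" where
  "normal_fun f \<longleftrightarrow> meromorphic_C f \<and>
     (\<forall>h :: nat \<Rightarrow> complex. \<exists>r. strict_mono r \<and>
        unif_cauchy_compacta (\<lambda>n z. sphere_val f (z + h (r n))))"

definition class_N1 :: "(complex \<Rightarrow> complex) \<Rightarrow> bool" where
  "class_N1 f \<longleftrightarrow> normal_fun f \<and>
     \<not> (\<exists>(h :: nat \<Rightarrow> complex) (c :: complex option).
          unif_conv_compacta (\<lambda>n z. sphere_val f (z + h n)) (\<lambda>_. c))"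

end

theory Submission
  imports Defs "HOL-Complex_Analysis.Great_Picard"
begin

text \<open>If \<open>f\<close> were arbitrarily small at points whose \<open>\<delta>\<close>-balls contain no zeros, a chordally
  convergent sequence of translates to these points would have, near the origin, zero-free
  holomorphic members and a limit vanishing at the origin. By Hurwitz the limit vanishes on a
  ball, and by equicontinuity and the identity theorem this spreads in steps of fixed radius to
  the whole plane, so 0 is a limit of translates, which is excluded. The upper bound is the same
  statement for the composition of \<open>f\<close> with the isometry \<open>w \<mapsto> 1/w\<close> of the sphere, and the bound on
  the logarithmic derivative follows from Cauchy's inequality on balls of radius \<open>\<delta>/2\<close>.\<close>

section \<open>The chordal metric\<close>

text \<open>Up to the factor 2 this is inversion in the unit sphere of \<open>complex \<times> real\<close>,
  applied to the plane at height 1; it maps that plane onto a sphere through the origin.\<close>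

fun stereo :: "complex option \<Rightarrow> complex \<times> real" where
  "stereo None = 0"
| "stereo (Some w) = (2 / (1 + (cmod w)\<^sup>2)) *\<^sub>R (w, 1)"

text \<open>Realizing the sphere inside the Euclidean space \<open>complex \<times> real\<close>
  makes symmetry and the triangle inequality immediate. For two finite points the squared distance
  is expanded in inner products; the remaining cases only need
  \<open>norm (stereo (Some w))\<close>, since \<open>stereo None\<close> is the origin.\<close>

lemma chordal_eq_dist: "chordal a b = dist (stereo a) (stereo b)"
proof -
  have pos: "1 + (cmod w)\<^sup>2 > 0" for w
    by (simp add: add_pos_nonneg)
  have n1: "norm (w, 1::real) = sqrt (1 + (cmod w)\<^sup>2)" for w :: complex
    by (simp add: norm_Pair add.commute)
  have one: "norm (stereo (Some w)) = 2 / sqrt (1 + (cmod w)\<^sup>2)" for w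
  proof -
    have "norm (stereo (Some w)) = 2 / (1 + (cmod w)\<^sup>2) * sqrt (1 + (cmod w)\<^sup>2)"
      using pos[of w] by (simp add: n1 del: scaleR_Pair)
    also have "\<dots> = 2 / sqrt (1 + (cmod w)\<^sup>2)"
      using pos[of w] real_sqrt_mult_self[of "1 + (cmod w)\<^sup>2"]
      by (simp add: field_simps)
    finally show ?thesis .
  qed
  have two: "dist (stereo (Some v)) (stereo (Some w)) = chordal (Some v) (Some w)" for v w
  proof -
    define V W where "V = 1 + (cmod v)\<^sup>2" and "W = 1 + (cmod w)\<^sup>2"
    have VW: "V > 0" "W > 0" using pos by (auto simp: V_def W_def)
    have e: "(cmod (v - w))\<^sup>2 = V + W - 2 - 2 * (v \<bullet> w)"
      by (simp add: V_def W_def power2_norm_eq_inner inner_diff inner_commute)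
    have V': "v \<bullet> v = V - 1" and W': "w \<bullet> w = W - 1"
      by (simp_all add: V_def W_def power2_norm_eq_inner)
    have "(dist (stereo (Some v)) (stereo (Some w)))\<^sup>2
        = (2 / V)\<^sup>2 * (v \<bullet> v) + (2 / W)\<^sup>2 * (w \<bullet> w) - 2 * (2 / V) * (2 / W) * (v \<bullet> w)
          + (2 / V - 2 / W)\<^sup>2"
    proof -
      have "(dist (a *\<^sub>R (v, 1::real)) (b *\<^sub>R (w, 1)))\<^sup>2
          = a\<^sup>2 * (v \<bullet> v) + b\<^sup>2 * (w \<bullet> w) - 2 * a * b * (v \<bullet> w) + (a - b)\<^sup>2" for a b
        by (simp add: dist_norm power2_norm_eq_inner inner_diff inner_commute)
          (simp add: power2_eq_square algebra_simps)
      then show ?thesis by (simp only: stereo.simps V_def W_def)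
    qed
    also have "\<dots> = 4 * (cmod (v - w))\<^sup>2 / (V * W)"
      unfolding e V' W' using VW by (simp add: field_simps power2_eq_square)
    finally have "dist (stereo (Some v)) (stereo (Some w)) = sqrt (4 * (cmod (v - w))\<^sup>2 / (V * W))"
      by (metis real_sqrt_unique zero_le_dist)
    also have "\<dots> = chordal (Some v) (Some w)"
      by (simp add: real_sqrt_divide real_sqrt_mult V_def W_def)
    finally show ?thesis .
  qed
  show ?thesis
    using one two by (cases a; cases b) (auto simp del: stereo.simps(2) simp: dist_norm)
qed

lemma chordal_self [simp]: "chordal a a = 0"
  and chordal_nonneg [simp]: "chordal a b \<ge> 0"
  and chordal_commute: "chordal a b = chordal b a"
  and chordal_triangle: "chordal a c \<le> chordal a b + chordal b c"
  by (auto simp: chordal_eq_dist dist_commute intro: dist_triangle)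

lemma chordal_le_norm: "chordal (Some v) (Some w) \<le> 2 * cmod (v - w)"
proof -
  have "1 * 1 \<le> (1 + (cmod v)\<^sup>2) * (1 + (cmod w)\<^sup>2)"
    by (intro mult_mono) auto
  then have "1 \<le> sqrt ((1 + (cmod v)\<^sup>2) * (1 + (cmod w)\<^sup>2))"
    by simp
  then have "2 * cmod (v - w) / sqrt ((1 + (cmod v)\<^sup>2) * (1 + (cmod w)\<^sup>2)) \<le> 2 * cmod (v - w) / 1"
    by (intro divide_left_mono) auto
  then show ?thesis by simp
qed

text \<open>On the closed unit disc both factors under the root are at most 2. Together with
  \<open>chordal_le_norm\<close> this makes the chordal and Euclidean metrics equivalent there, so
  chordal Cauchy sequences turn into ordinary ones.\<close>

lemma norm_le_chordal:
  assumes "cmod v \<le> 1" "cmod w \<le> 1"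
  shows "cmod (v - w) \<le> chordal (Some v) (Some w)"
proof -
  have p: "0 < (1 + (cmod v)\<^sup>2) * (1 + (cmod w)\<^sup>2)"
    by (intro mult_pos_pos add_pos_nonneg) auto
  have "(1 + (cmod v)\<^sup>2) * (1 + (cmod w)\<^sup>2) \<le> 2 * 2"
    using assms by (intro mult_mono) (auto simp: power_le_one)
  then have "sqrt ((1 + (cmod v)\<^sup>2) * (1 + (cmod w)\<^sup>2)) \<le> 2"
    by (intro real_le_lsqrt) auto
  then have "2 * cmod (v - w) / 2 \<le> 2 * cmod (v - w) / sqrt ((1 + (cmod v)\<^sup>2) * (1 + (cmod w)\<^sup>2))"
    using p by (intro divide_left_mono) auto
  then show ?thesis by simp
qed

text \<open>Infinity is at distance 2 from 0, and for finite \<open>w\<close> the hypothesis means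
  \<open>3 * (cmod w)\<^sup>2 < 1\<close>. The weaker bound in the conclusion is what
  \<open>norm_le_chordal\<close> asks for.\<close>

lemma chordal_zero_less_one:
  assumes "chordal a (Some 0) < 1"
  obtains w where "a = Some w" "cmod w < 1"
proof (cases a)
  case (Some w)
  have p: "1 + (cmod w)\<^sup>2 > 0" by (simp add: add_pos_nonneg)
  have "2 * cmod w / sqrt (1 + (cmod w)\<^sup>2) < 1"
    using assms Some by simp
  then have "2 * cmod w < sqrt (1 + (cmod w)\<^sup>2)"
    using p by (simp add: divide_simps)
  then have "(2 * cmod w)\<^sup>2 < 1 + (cmod w)\<^sup>2"
    using p power_strict_mono[of "2 * cmod w" "sqrt (1 + (cmod w)\<^sup>2)" 2] by simp
  then have "(cmod w)\<^sup>2 < 1"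
    by (simp add: power_mult_distrib)
  then show ?thesis using that Some by (simp add: abs_square_less_1)
qed (use assms in simp)

text \<open>The map \<open>w \<mapsto> 1/w\<close> of the sphere. The case \<open>w = 0\<close> is
  separate because \<open>inverse 0 = 0\<close>.\<close>

fun sinv :: "complex option \<Rightarrow> complex option" where
  "sinv None = Some 0"
| "sinv (Some w) = (if w = 0 then None else Some (inverse w))"

lemma sinv_sinv [simp]: "sinv (sinv a) = a"
  by (cases a) auto

lemma sinv_eq_zero_iff [simp]: "sinv a = Some 0 \<longleftrightarrow> a = None"
  by (cases a) auto

lemma sinv_eq_None_iff [simp]: "sinv a = None \<longleftrightarrow> a = Some 0"
  by (cases a) auto

text \<open>Inversion is a rotation of the sphere. The computation rests on \<open>q\<close>:
  replacing \<open>w\<close> by \<open>1/w\<close> divides \<open>1 + (cmod w)\<^sup>2\<close> by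
  \<open>(cmod w)\<^sup>2\<close>, and these factors cancel against the numerator.\<close>

lemma chordal_sinv [simp]: "chordal (sinv a) (sinv b) = chordal a b"
proof -
  have q: "1 + (cmod (inverse w))\<^sup>2 = (1 + (cmod w)\<^sup>2) / (cmod w)\<^sup>2" if "w \<noteq> 0" for w
    using that by (simp add: field_simps norm_divide)
  have 0: "chordal (Some (inverse w)) (Some 0) = chordal (Some w) None" if "w \<noteq> 0" for w
  proof -
    have "chordal (Some (inverse w)) (Some 0) = 2 * cmod (inverse w) / sqrt (1 + (cmod (inverse w))\<^sup>2)"
      by simp
    also have "\<dots> = chordal (Some w) None"
      unfolding q[OF that] using that by (simp add: real_sqrt_divide norm_inverse)
    finally show ?thesis .
  qed
  have 1: "chordal (Some (inverse w)) None = chordal (Some w) (Some 0)" if "w \<noteq> 0" for w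
    using 0[of "inverse w"] that by simp
  have 2: "chordal (Some (inverse v)) (Some (inverse w)) = chordal (Some v) (Some w)"
    if "v \<noteq> 0" "w \<noteq> 0" for v w
  proof -
    have "inverse v - inverse w = (w - v) / (v * w)"
      using that by (simp add: field_simps)
    then have "cmod (inverse v - inverse w) = cmod (v - w) / (cmod v * cmod w)"
      by (simp add: norm_divide norm_mult norm_minus_commute)
    then show ?thesis
      using that by (simp only: chordal.simps q[OF that(1)] q[OF that(2)] real_sqrt_mult real_sqrt_divide) simp
  qed
  show ?thesis
    using 0 1 2 by (cases a; cases b) (auto simp: chordal_commute simp del: chordal.simps(2-4))
qed

section \<open>Maps into the sphere that are holomorphic or reciprocals of such\<close>

definition sphere_holomorphic :: "(complex \<Rightarrow> complex option) \<Rightarrow> bool" where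
  "sphere_holomorphic F \<longleftrightarrow> (\<forall>z. \<exists>e>0. \<exists>g. g holomorphic_on ball z e \<and>
     ((\<forall>w\<in>ball z e. F w = Some (g w)) \<or> (\<forall>w\<in>ball z e. F w = sinv (Some (g w)))))"

lemma sphere_holomorphicE:
  assumes "sphere_holomorphic F"
  obtains e g where "e > 0" "g holomorphic_on ball z e"
    "(\<forall>w\<in>ball z e. F w = Some (g w)) \<or> (\<forall>w\<in>ball z e. F w = sinv (Some (g w)))"
  using assms unfolding sphere_holomorphic_def by meson

lemma sphere_holomorphic_sinv:
  assumes "sphere_holomorphic F"
  shows "sphere_holomorphic (\<lambda>z. sinv (F z))"
  unfolding sphere_holomorphic_def
proof
  fix z
  obtain e g where eg: "e > 0" "g holomorphic_on ball z e"
    "(\<forall>w\<in>ball z e. F w = Some (g w)) \<or> (\<forall>w\<in>ball z e. F w = sinv (Some (g w)))"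
    using sphere_holomorphicE[OF assms] .
  then have "(\<forall>w\<in>ball z e. sinv (F w) = Some (g w)) \<or> (\<forall>w\<in>ball z e. sinv (F w) = sinv (Some (g w)))"
    by (metis sinv_sinv)
  then show "\<exists>e>0. \<exists>g. g holomorphic_on ball z e \<and>
     ((\<forall>w\<in>ball z e. sinv (F w) = Some (g w)) \<or> (\<forall>w\<in>ball z e. sinv (F w) = sinv (Some (g w))))"
    using eg by blast
qed

lemma sphere_holomorphic_translate:
  assumes "sphere_holomorphic F"
  shows "sphere_holomorphic (\<lambda>z. F (z + h))"
  unfolding sphere_holomorphic_def
proof
  fix z
  obtain e g where eg: "e > 0" "g holomorphic_on ball (z + h) e"
    "(\<forall>w\<in>ball (z + h) e. F w = Some (g w)) \<or> (\<forall>w\<in>ball (z + h) e. F w = sinv (Some (g w)))"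
    using sphere_holomorphicE[OF assms] .
  have sub: "w + h \<in> ball (z + h) e" if "w \<in> ball z e" for w
    using that by (simp add: dist_norm)
  have "(g \<circ> (\<lambda>w. w + h)) holomorphic_on ball z e"
    by (rule holomorphic_on_compose_gen[OF _ eg(2)]) (use sub in \<open>auto intro!: holomorphic_intros\<close>)
  moreover have "(\<forall>w\<in>ball z e. F (w + h) = Some ((g \<circ> (\<lambda>w. w + h)) w)) \<or>
      (\<forall>w\<in>ball z e. F (w + h) = sinv (Some ((g \<circ> (\<lambda>w. w + h)) w)))"
    using eg(3) sub by (metis comp_apply)
  ultimately show "\<exists>e>0. \<exists>g. g holomorphic_on ball z e \<and>
     ((\<forall>w\<in>ball z e. F (w + h) = Some (g w)) \<or> (\<forall>w\<in>ball z e. F (w + h) = sinv (Some (g w))))"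
    using eg(1) by blast
qed

lemma sphere_holomorphic_finite:
  assumes F: "sphere_holomorphic F" and "open S" and S: "\<And>z. z \<in> S \<Longrightarrow> F z \<noteq> None"
  shows "(\<lambda>z. the (F z)) holomorphic_on S"
proof -
  have "(\<lambda>z. the (F z)) field_differentiable (at z)" if z: "z \<in> S" for z
  proof -
    obtain e g where eg: "e > 0" "g holomorphic_on ball z e"
      "(\<forall>w\<in>ball z e. F w = Some (g w)) \<or> (\<forall>w\<in>ball z e. F w = sinv (Some (g w)))"
      using sphere_holomorphicE[OF F] .
    define U where "U = ball z e \<inter> S"
    have U: "open U" "z \<in> U" using eg(1) z \<open>open S\<close> by (auto simp: U_def)
    have g: "g holomorphic_on U"
      using eg(2) by (rule holomorphic_on_subset) (auto simp: U_def)
    from eg(3) have "(\<lambda>z. the (F z)) holomorphic_on U"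
    proof
      assume "\<forall>w\<in>ball z e. F w = Some (g w)"
      then show ?thesis
        by (intro holomorphic_transform[OF g]) (auto simp: U_def)
    next
      assume *: "\<forall>w\<in>ball z e. F w = sinv (Some (g w))"
      \<comment> \<open>A zero of \<open>g\<close> in the reciprocal chart would be a point where
        \<open>F\<close> is \<open>None\<close>.\<close>
      have nz: "g w \<noteq> 0" if "w \<in> U" for w
        using * S[of w] that by (auto simp: U_def)
      show ?thesis
        by (rule holomorphic_transform[of "\<lambda>w. inverse (g w)"])
          (use g nz * in \<open>auto simp: U_def intro!: holomorphic_intros\<close>)
    qed
    then show ?thesis
      using U holomorphic_on_imp_differentiable_at by blast
  qed
  then show ?thesis
    by (simp add: holomorphic_on_def field_differentiable_at_within)
qed

lemma sphere_holomorphic_continuous: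
  assumes F: "sphere_holomorphic F" and "\<epsilon> > 0"
  shows "\<exists>d>0. \<forall>w\<in>ball z d. chordal (F w) (F z) < \<epsilon>"
proof -
  obtain e g where eg: "e > 0" "g holomorphic_on ball z e"
    "(\<forall>w\<in>ball z e. F w = Some (g w)) \<or> (\<forall>w\<in>ball z e. F w = sinv (Some (g w)))"
    using sphere_holomorphicE[OF F] .
  have "continuous_on (ball z e) g" using eg(2) holomorphic_on_imp_continuous_on by blast
  then have "isCont g z" using eg(1) by (simp add: continuous_on_eq_continuous_at)
  then obtain d where d: "d > 0" "\<And>w. dist w z < d \<Longrightarrow> dist (g w) (g z) < \<epsilon> / 2"
    using \<open>\<epsilon> > 0\<close> unfolding continuous_at_eps_delta by (metis half_gt_zero)
  have "chordal (F w) (F z) < \<epsilon>" if "w \<in> ball z (min d e)" for w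
  proof -
    \<comment> \<open>Holds in both charts, since \<open>sinv\<close> is an isometry.\<close>
    have "chordal (F w) (F z) = chordal (Some (g w)) (Some (g z))"
      using eg that by (metis centre_in_ball chordal_sinv mem_ball min_less_iff_conj)
    also have "\<dots> \<le> 2 * cmod (g w - g z)" by (rule chordal_le_norm)
    also have "\<dots> < \<epsilon>" using d(2)[of w] that by (simp add: dist_norm norm_minus_commute)
    finally show ?thesis .
  qed
  then show ?thesis using d eg(1) by (intro exI[of _ "min d e"]) auto
qed

text \<open>Away from the poles \<open>f\<close> itself is a chart. A pole is isolated, and
  \<open>1/f\<close> tends to 0 there, so the singularity of \<open>1/f\<close> is removable and the
  reciprocal chart applies.\<close>

lemma sphere_holomorphic_sphere_val:
  assumes "meromorphic_C f"
  shows "sphere_holomorphic (sphere_val f)"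
  unfolding sphere_holomorphic_def
proof
  fix z
  let ?P = "pole_set f"
  have hol: "f holomorphic_on - ?P" and "\<not> z islimpt ?P"
    using assms by (auto simp: meromorphic_C_def)
  then obtain T where T: "open T" "z \<in> T" "\<And>w. w \<in> ?P \<Longrightarrow> w \<in> T \<Longrightarrow> w = z"
    unfolding islimpt_def by metis
  show "\<exists>e>0. \<exists>g. g holomorphic_on ball z e \<and> ((\<forall>w\<in>ball z e. sphere_val f w = Some (g w)) \<or>
     (\<forall>w\<in>ball z e. sphere_val f w = sinv (Some (g w))))"
  proof (cases "z \<in> ?P")
    case False
    obtain e where e: "e > 0" "ball z e \<subseteq> T" using T open_contains_ball by blast
    then have "ball z e \<subseteq> - ?P" using T False by blast
    then show ?thesis
      using e hol by (intro exI[of _ e] conjI exI[of _ f])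
        (auto simp: sphere_val_def intro: holomorphic_on_subset)
  next
    case True
    then have lim: "filterlim f at_infinity (at z)" by (simp add: pole_set_def)
    then have "eventually (\<lambda>w. f w \<noteq> 0) (at z)"
      using filterlim_at_infinity_imp_eventually_ne by blast
    then obtain d where d: "d > 0" "\<And>w. w \<noteq> z \<Longrightarrow> dist w z < d \<Longrightarrow> f w \<noteq> 0"
      by (auto simp: eventually_at)
    obtain e where e: "e > 0" "ball z e \<subseteq> T" using T open_contains_ball by blast
    define r where "r = min d e"
    have r: "r > 0" using d e by (simp add: r_def)
    \<comment> \<open>The value of \<open>f\<close> at its pole is arbitrary, so the limit 0 is
      inserted by hand.\<close>
    define g where "g = (\<lambda>w. if w = z then 0 else inverse (f w))"
    have nz: "f w \<noteq> 0" "w \<notin> ?P" if "w \<in> ball z r - {z}" for w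
    proof -
      have w: "w \<noteq> z" "w \<in> ball z d" "w \<in> ball z e" using that by (auto simp: r_def)
      then show "f w \<noteq> 0" by (intro d(2)) (auto simp: dist_commute)
      show "w \<notin> ?P" using w e(2) T(3) by blast
    qed
    have "(\<lambda>w. inverse (f w)) holomorphic_on ball z r - {z}"
      using nz by (intro holomorphic_intros holomorphic_on_subset[OF hol]) auto
    then have gh: "g holomorphic_on ball z r - {z}"
      by (rule holomorphic_transform) (auto simp: g_def)
    have "((\<lambda>w. inverse (f w)) \<longlongrightarrow> 0) (at z)"
      using lim by (rule filterlim_compose[OF tendsto_inverse_0])
    then have "(g \<longlongrightarrow> 0) (at z)"
      by (rule Lim_transform_eventually) (auto simp: g_def eventually_at_filter)
    then have gc: "isCont g z"
      by (simp add: isCont_def g_def)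
    have "isCont g w" if "w \<in> ball z r" for w
    proof (cases "w = z")
      case False
      have "continuous_on (ball z r - {z}) g"
        using gh holomorphic_on_imp_continuous_on by blast
      then show ?thesis
        using False that by (simp add: continuous_on_eq_continuous_at open_delete)
    qed (use gc in simp)
    then have "continuous_on (ball z r) g"
      by (simp add: continuous_at_imp_continuous_on)
    then have "g holomorphic_on ball z r"
      by (rule no_isolated_singularity[OF _ gh]) auto
    moreover have "\<forall>w\<in>ball z r. sphere_val f w = sinv (Some (g w))"
      using nz True by (auto simp: sphere_val_def g_def)
    ultimately show ?thesis using r by blast
  qed
qed

section \<open>Normal families of translates\<close>

text \<open>Stated for sphere-valued maps so that it covers both \<open>sphere_val f\<close> and its
  inversion.\<close>

definition normal_translates :: "(complex \<Rightarrow> complex option) \<Rightarrow> bool" where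
  "normal_translates F \<longleftrightarrow> sphere_holomorphic F \<and>
     (\<forall>h :: nat \<Rightarrow> complex. \<exists>r. strict_mono r \<and> unif_cauchy_compacta (\<lambda>n z. F (z + h (r n))))"

text \<open>The radius is uniform over the whole plane: pairs violating this at ever smaller
  distance are translated to the origin, where a Cauchy subsequence stays close to one fixed
  translate, which is continuous.\<close>

lemma normal_translates_equicontinuous:
  assumes F: "normal_translates F" and "\<epsilon> > 0"
  obtains r where "r > 0" "\<And>z w. dist z w < r \<Longrightarrow> chordal (F z) (F w) < \<epsilon>"
proof (rule ccontr)
  assume contr: "\<not> thesis"
  have "\<exists>z w. dist z w < 1 / real (Suc n) \<and> \<not> chordal (F z) (F w) < \<epsilon>" for n
  proof (rule ccontr)
    assume "\<not> ?thesis"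
    then have thesis by (intro that[of "1 / real (Suc n)"]) auto
    with contr show False by blast
  qed
  then obtain z w where zw: "\<And>n. dist (z n) (w n) < 1 / real (Suc n)"
      "\<And>n. \<not> chordal (F (z n)) (F (w n)) < \<epsilon>"
    by metis
  obtain r where r: "strict_mono r" "unif_cauchy_compacta (\<lambda>n u. F (u + z (r n)))"
    using F unfolding normal_translates_def by meson
  have "\<exists>N. \<forall>m\<ge>N. \<forall>n\<ge>N. \<forall>u\<in>cball 0 1. chordal (F (u + z (r m))) (F (u + z (r n))) < \<epsilon> / 3"
    using r(2) \<open>\<epsilon> > 0\<close> unfolding unif_cauchy_compacta_def
    by (metis compact_cball divide_pos_pos zero_less_numeral)
  then obtain N where N: "\<And>m n u. m \<ge> N \<Longrightarrow> n \<ge> N \<Longrightarrow> u \<in> cball 0 1 \<Longrightarrow>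
      chordal (F (u + z (r m))) (F (u + z (r n))) < \<epsilon> / 3"
    by meson
  have "sphere_holomorphic F" using F by (simp add: normal_translates_def)
  then obtain d where d: "d > 0" "\<And>v. v \<in> ball (z (r N)) d \<Longrightarrow> chordal (F v) (F (z (r N))) < \<epsilon> / 3"
    using sphere_holomorphic_continuous[of F "\<epsilon> / 3" "z (r N)"] \<open>\<epsilon> > 0\<close> by auto
  obtain M where M: "1 / real (Suc M) < d" using nat_approx_posE[OF d(1)] by blast
  \<comment> \<open>\<open>N\<close> activates the Cauchy estimate; \<open>M\<close>, with
    \<open>r n \<ge> n\<close>, brings the pair within the continuity radius
    \<open>d\<close>.\<close>
  define n where "n = max N M"
  have "r n \<ge> n" using r(1) seq_suble by blast
  then have "M \<le> r n" by (simp add: n_def)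
  then have "1 / real (Suc (r n)) \<le> 1 / real (Suc M)" by (simp add: frac_le)
  with zw(1)[of "r n"] M have small: "dist (z (r n)) (w (r n)) < d" by linarith
  have le1: "dist (z (r n)) (w (r n)) \<le> 1"
    using zw(1)[of "r n"] by (rule less_imp_le[OF less_le_trans]) simp
  define u where "u = w (r n) - z (r n)"
  have u: "u \<in> cball 0 1" using le1 by (simp add: u_def dist_norm norm_minus_commute)
  have 1: "chordal (F (0 + z (r n))) (F (0 + z (r N))) < \<epsilon> / 3"
    by (rule N) (auto simp: n_def)
  have 2: "chordal (F (u + z (r n))) (F (u + z (r N))) < \<epsilon> / 3"
    by (rule N) (use u in \<open>auto simp: n_def\<close>)
  have 3: "chordal (F (u + z (r N))) (F (z (r N))) < \<epsilon> / 3"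
    by (rule d) (use small in \<open>simp add: u_def dist_norm norm_minus_commute\<close>)
  have "chordal (F (z (r n))) (F (w (r n))) < \<epsilon>"
    using 1 2 3 chordal_triangle[of "F (z (r n))" "F (u + z (r n))" "F (z (r N))"]
      chordal_triangle[of "F (u + z (r n))" "F (z (r N))" "F (u + z (r N))"]
    by (simp add: u_def chordal_commute)
  with zw(2) show False by blast
qed

text \<open>By \<open>eqc\<close> and the smallness at \<open>p\<close>, late translates stay within
  distance 1 of 0 on the ball, hence in the unit disc. There the chordal Cauchy property gives
  uniform convergence of holomorphic functions, and the zeros of \<open>g\<close> record where the
  translates tend to 0.\<close>

lemma local_limit:
  fixes G :: "nat \<Rightarrow> complex \<Rightarrow> complex option"
  assumes hol: "\<And>n. sphere_holomorphic (G n)"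
    and eqc: "\<And>n z. z \<in> ball p r \<Longrightarrow> chordal (G n z) (G n p) < 1/2"
    and cau: "unif_cauchy_compacta G"
    and lim: "(\<lambda>n. chordal (G n p) (Some 0)) \<longlonglongrightarrow> 0"
  obtains N g where "\<And>n z. z \<in> ball p r \<Longrightarrow> G (n + N) z \<noteq> None"
    "\<And>n. (\<lambda>z. the (G (n + N) z)) holomorphic_on ball p r"
    "uniform_limit (ball p r) (\<lambda>n z. the (G (n + N) z)) g sequentially"
    "g holomorphic_on ball p r"
    "\<And>z. z \<in> ball p r \<Longrightarrow> g z = 0 \<longleftrightarrow> (\<lambda>n. chordal (G n z) (Some 0)) \<longlonglongrightarrow> 0"
proof -
  have "eventually (\<lambda>n. chordal (G n p) (Some 0) < 1/2) sequentially"
    using lim by (rule order_tendstoD) simp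
  then obtain N where "\<forall>n\<ge>N. chordal (G n p) (Some 0) < 1/2"
    unfolding eventually_sequentially by blast
  then have N: "chordal (G (n + N) p) (Some 0) < 1/2" for n by simp
  \<comment> \<open>The shift by \<open>N\<close> discards the early translates, which may have
    poles in the ball.\<close>
  define k where "k = (\<lambda>n z. the (G (n + N) z))"
  have k: "G (n + N) z = Some (k n z)" "cmod (k n z) < 1" if "z \<in> ball p r" for n z
  proof -
    have "chordal (G (n + N) z) (Some 0) < 1"
      using chordal_triangle[of "G (n + N) z" "Some 0" "G (n + N) p"] N[of n] eqc[OF that, of "n + N"]
      by linarith
    then obtain w where "G (n + N) z = Some w" "cmod w < 1"
      by (rule chordal_zero_less_one)
    then show "G (n + N) z = Some (k n z)" "cmod (k n z) < 1" by (auto simp: k_def)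
  qed
  have khol: "k n holomorphic_on ball p r" for n
    unfolding k_def using k(1) by (intro sphere_holomorphic_finite hol) auto
  have "uniformly_Cauchy_on (ball p r) k"
  proof (rule uniformly_Cauchy_onI)
    fix e :: real assume "e > 0"
    then obtain M where M: "\<And>m n z. m \<ge> M \<Longrightarrow> n \<ge> M \<Longrightarrow> z \<in> cball p r \<Longrightarrow> chordal (G m z) (G n z) < e"
      using cau unfolding unif_cauchy_compacta_def by (metis compact_cball)
    have "dist (k m z) (k n z) < e" if "z \<in> ball p r" "m \<ge> M" "n \<ge> M" for z m n
    proof -
      have "dist (k m z) (k n z) \<le> chordal (Some (k m z)) (Some (k n z))"
        unfolding dist_norm using k(2)[OF that(1)] by (intro norm_le_chordal) (auto intro: less_imp_le)
      also have "\<dots> = chordal (G (m + N) z) (G (n + N) z)" using k(1)[OF that(1)] by simp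
      also have "\<dots> < e" using that by (intro M) auto
      finally show ?thesis .
    qed
    then show "\<exists>M. \<forall>x\<in>ball p r. \<forall>m\<ge>M. \<forall>n\<ge>M. dist (k m x) (k n x) < e" by blast
  qed
  then obtain g where g: "uniform_limit (ball p r) k g sequentially"
    using Cauchy_uniformly_convergent uniformly_convergent_on_def by blast
  have ghol: "g holomorphic_on ball p r"
  proof (rule holomorphic_uniform_sequence[OF open_ball khol])
    fix x assume "x \<in> ball p r"
    then obtain d where "d > 0" "cball x d \<subseteq> ball p r"
      using open_ball open_contains_cball by blast
    then show "\<exists>d>0. cball x d \<subseteq> ball p r \<and> uniform_limit (cball x d) k g sequentially"
      using g uniform_limit_on_subset by blast
  qed
  have gz: "g z = 0 \<longleftrightarrow> (\<lambda>n. chordal (G n z) (Some 0)) \<longlonglongrightarrow> 0" if z: "z \<in> ball p r" for z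
  proof -
    have kl: "(\<lambda>n. k n z) \<longlonglongrightarrow> g z" using g z by (rule tendsto_uniform_limitI)
    have "(\<lambda>n. chordal (G n z) (Some 0)) \<longlonglongrightarrow> 0 \<longleftrightarrow> (\<lambda>n. chordal (G (n + N) z) (Some 0)) \<longlonglongrightarrow> 0"
      by (rule iffI, erule LIMSEQ_ignore_initial_segment, erule LIMSEQ_offset)
    also have "\<dots> \<longleftrightarrow> (\<lambda>n. chordal (Some (k n z)) (Some 0)) \<longlonglongrightarrow> 0" using k(1)[OF z] by simp
    also have "\<dots> \<longleftrightarrow> (\<lambda>n. k n z) \<longlonglongrightarrow> 0"
    proof
      assume "(\<lambda>n. chordal (Some (k n z)) (Some 0)) \<longlonglongrightarrow> 0"
      then show "(\<lambda>n. k n z) \<longlonglongrightarrow> 0"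
        by (rule Lim_null_comparison[rotated])
          (use norm_le_chordal[of _ 0] less_imp_le[OF k(2)[OF z]] in \<open>auto intro!: always_eventually simp del: chordal.simps\<close>)
    next
      assume "(\<lambda>n. k n z) \<longlonglongrightarrow> 0"
      then have "(\<lambda>n. 2 * cmod (k n z)) \<longlonglongrightarrow> 0"
        by (intro tendsto_mult_right_zero tendsto_norm_zero)
      then show "(\<lambda>n. chordal (Some (k n z)) (Some 0)) \<longlonglongrightarrow> 0"
        by (rule Lim_null_comparison[rotated])
          (use chordal_le_norm[of _ 0] in \<open>auto intro!: always_eventually simp del: chordal.simps\<close>)
    qed
    also have "\<dots> \<longleftrightarrow> g z = 0" using kl LIMSEQ_unique by auto
    finally show ?thesis by simp
  qed
  show ?thesis
    by (rule that[of N g]) (use k(1) khol g ghol gz in \<open>auto simp: k_def\<close>)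
qed

text \<open>The auxiliary index \<open>m\<close> may depend on the point, but the Cauchy index
  \<open>N\<close> does not.\<close>

lemma pointwise_limit_imp_unif_conv:
  assumes cau: "unif_cauchy_compacta G" and lim: "\<And>z. (\<lambda>n. chordal (G n z) c) \<longlonglongrightarrow> 0"
  shows "unif_conv_compacta G (\<lambda>_. c)"
  unfolding unif_conv_compacta_def
proof (intro allI impI)
  fix K :: "complex set" and e :: real assume "compact K" "e > 0"
  then obtain N where N: "\<And>m n z. m \<ge> N \<Longrightarrow> n \<ge> N \<Longrightarrow> z \<in> K \<Longrightarrow> chordal (G m z) (G n z) < e / 2"
    using cau unfolding unif_cauchy_compacta_def by (metis half_gt_zero)
  have "chordal (G n z) c < e" if "n \<ge> N" "z \<in> K" for n z
  proof -
    have "eventually (\<lambda>m. chordal (G m z) c < e / 2) sequentially"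
      using lim by (rule order_tendstoD) (use \<open>e > 0\<close> in simp)
    then obtain m where "m \<ge> N" "chordal (G m z) c < e / 2"
      using eventually_happens[OF eventually_conj[OF eventually_ge_at_top[of N]]] by fastforce
    then show ?thesis
      using N[of n m z] that chordal_triangle[of "G n z" c "G m z"] by linarith
  qed
  then show "\<exists>N. \<forall>n\<ge>N. \<forall>z\<in>K. chordal (G n z) c < e" by blast
qed

text \<open>Phrased with the chordal distance and for general \<open>F\<close>, so that it yields
  the lower bound for \<open>f\<close> and, after inversion, the upper bound.\<close>

lemma bounded_away_from_zero:
  assumes F: "normal_translates F" and "\<delta> > 0"
    and nonconst: "\<And>h :: nat \<Rightarrow> complex. \<not> unif_conv_compacta (\<lambda>n z. F (z + h n)) (\<lambda>_. Some 0)"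
  obtains \<eta> where "\<eta> > 0"
    "\<And>z. (\<And>w. w \<in> ball z \<delta> \<Longrightarrow> F w \<noteq> Some 0) \<Longrightarrow> \<eta> \<le> chordal (F z) (Some 0)"
proof (rule ccontr)
  assume contr: "\<not> thesis"
  have "\<exists>z. (\<forall>w\<in>ball z \<delta>. F w \<noteq> Some 0) \<and> chordal (F z) (Some 0) < 1 / real (Suc n)" for n
  proof (rule ccontr)
    assume *: "\<not> ?thesis"
    have thesis
    proof (rule that[of "1 / real (Suc n)"])
      fix z assume "\<And>w. w \<in> ball z \<delta> \<Longrightarrow> F w \<noteq> Some 0"
      then show "1 / real (Suc n) \<le> chordal (F z) (Some 0)" using * by (meson not_le)
    qed simp
    with contr show False by blast
  qed
  then obtain z where z: "\<And>n w. w \<in> ball (z n) \<delta> \<Longrightarrow> F w \<noteq> Some 0"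
      "\<And>n. chordal (F (z n)) (Some 0) < 1 / real (Suc n)"
    by metis
  obtain s where s: "strict_mono s" "unif_cauchy_compacta (\<lambda>n u. F (u + z (s n)))"
    using F unfolding normal_translates_def by meson
  define G where "G = (\<lambda>n u. F (u + z (s n)))"
  have cau: "unif_cauchy_compacta G" using s(2) by (simp add: G_def)
  have hol: "sphere_holomorphic (G n)" for n
    unfolding G_def using F by (intro sphere_holomorphic_translate) (simp add: normal_translates_def)
  obtain r where r: "r > 0" "\<And>z w. dist z w < r \<Longrightarrow> chordal (F z) (F w) < 1/2"
    using normal_translates_equicontinuous[OF F, of "1/2"] by auto
  have eqc: "chordal (G n u) (G n p) < 1/2" if "u \<in> ball p r" for n u p
    unfolding G_def using that by (intro r) (simp add: dist_commute)
  \<comment> \<open>The zero set of the limit, described pointwise without forming a global limit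
    function.\<close>
  define L where "L = {p. (\<lambda>n. chordal (G n p) (Some 0)) \<longlonglongrightarrow> 0}"
  have "(\<lambda>n. chordal (F (z n)) (Some 0)) \<longlonglongrightarrow> 0"
    by (rule Lim_null_comparison[OF _ LIMSEQ_inverse_real_of_nat])
      (use z(2) in \<open>auto intro!: always_eventually less_imp_le simp: inverse_eq_divide\<close>)
  then have "0 \<in> L"
    using LIMSEQ_subseq_LIMSEQ[OF _ s(1)] by (fastforce simp: L_def G_def comp_def)
  \<comment> \<open>Radius \<open>r\<close> provides a holomorphic limit, radius
    \<open>\<delta>\<close> keeps the translates free of zeros. Since \<open>g 0 = 0\<close>,
    Hurwitz then forces \<open>g\<close> to be constant.\<close>
  have start: "ball 0 (min r \<delta>) \<subseteq> L"
  proof -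
    obtain N g where Ng: "\<And>n u. u \<in> ball 0 r \<Longrightarrow> G (n + N) u \<noteq> None"
        "\<And>n. (\<lambda>u. the (G (n + N) u)) holomorphic_on ball 0 r"
        "uniform_limit (ball 0 r) (\<lambda>n u. the (G (n + N) u)) g sequentially"
        "g holomorphic_on ball 0 r"
        "\<And>u. u \<in> ball 0 r \<Longrightarrow> g u = 0 \<longleftrightarrow> (\<lambda>n. chordal (G n u) (Some 0)) \<longlonglongrightarrow> 0"
      by (rule local_limit[of G 0 r]) (use hol eqc cau \<open>0 \<in> L\<close> in \<open>auto simp: L_def\<close>)
    let ?B = "ball 0 (min r \<delta>) :: complex set"
    have sub: "?B \<subseteq> ball 0 r" by auto
    have 0: "0 \<in> ?B" "g 0 = 0" using r(1) \<open>\<delta> > 0\<close> Ng(5)[of 0] \<open>0 \<in> L\<close> by (auto simp: L_def)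
    have nz: "the (G (n + N) u) \<noteq> 0" if "u \<in> ?B" for n u
    proof -
      have "u + z (s (n + N)) \<in> ball (z (s (n + N))) \<delta>"
        using that by (simp add: dist_norm)
      then have "G (n + N) u \<noteq> Some 0" using z(1) by (simp add: G_def)
      then show ?thesis using Ng(1)[of u n] that by auto
    qed
    have "g constant_on ?B"
    proof (rule ccontr)
      assume nc: "\<not> g constant_on ?B"
      have "g 0 \<noteq> 0"
      proof (rule Hurwitz_no_zeros[of ?B "\<lambda>n u. the (G (n + N) u)" g 0])
        show "(\<lambda>u. the (G (n + N) u)) holomorphic_on ?B" for n
          using Ng(2) sub by (rule holomorphic_on_subset)
        show "g holomorphic_on ?B"
          using Ng(4) sub by (rule holomorphic_on_subset)
        show "uniform_limit K (\<lambda>n u. the (G (n + N) u)) g sequentially" 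
          if "compact K" "K \<subseteq> ?B" for K
          by (rule uniform_limit_on_subset[OF Ng(3)]) (use that sub in blast)
      qed (use nc nz 0 in \<open>simp_all only: open_ball connected_ball not_False_eq_True\<close>)
      with 0 show False by blast
    qed
    then have "g u = 0" if "u \<in> ?B" for u using that 0 unfolding constant_on_def by metis
    then show ?thesis using Ng(5) by (auto simp: L_def)
  qed
  \<comment> \<open>At an interior point the zeros of the local limit accumulate, as the identity
    theorem requires. The step length \<open>r\<close> is the same at every point, so
    \<open>A\<close> is closed as well as open.\<close>
  define A where "A = interior L"
  have step: "ball p r \<subseteq> A" if p: "p \<in> A" for p
  proof -
    obtain e where e: "e > 0" "ball p e \<subseteq> L"
      using p by (auto simp: A_def mem_interior)
    then have "p \<in> L" by auto
    obtain N g where Ng: "\<And>n u. u \<in> ball p r \<Longrightarrow> G (n + N) u \<noteq> None"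
        "\<And>n. (\<lambda>u. the (G (n + N) u)) holomorphic_on ball p r"
        "uniform_limit (ball p r) (\<lambda>n u. the (G (n + N) u)) g sequentially"
        "g holomorphic_on ball p r"
        "\<And>u. u \<in> ball p r \<Longrightarrow> g u = 0 \<longleftrightarrow> (\<lambda>n. chordal (G n u) (Some 0)) \<longlonglongrightarrow> 0"
      by (rule local_limit[of G p r]) (use hol eqc cau \<open>p \<in> L\<close> in \<open>auto simp: L_def\<close>)
    let ?U = "ball p (min r e)"
    have lim: "p islimpt ?U" using r(1) e(1) by (simp add: islimpt_ball)
    have gU: "g u = 0" if "u \<in> ?U" for u using Ng(5)[of u] e(2) that by (auto simp: L_def)
    have "g w = 0" if "w \<in> ball p r" for w
      using analytic_continuation[OF Ng(4) open_ball connected_ball _ _ lim gU that] r(1)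
      by (simp add: subset_ball)
    then have "ball p r \<subseteq> L" using Ng(5) by (auto simp: L_def)
    then show ?thesis unfolding A_def by (simp add: interior_maximal)
  qed
  have "0 \<in> A" using start r(1) \<open>\<delta> > 0\<close> unfolding A_def mem_interior
    by (intro exI[of _ "min r \<delta>"]) simp
  have "closed A"
    unfolding closed_limpt
  proof (intro allI impI)
    fix x assume "x islimpt A"
    then obtain p where "p \<in> A" "dist p x < r" using r(1) by (auto simp: islimpt_approachable)
    then show "x \<in> A" using step[of p] by auto
  qed
  moreover have "open A" by (simp add: A_def)
  ultimately have "A = UNIV" using \<open>0 \<in> A\<close> clopen by blast
  then have "L = UNIV" unfolding A_def using interior_subset by blast
  then have "unif_conv_compacta G (\<lambda>_. Some 0)"
    by (intro pointwise_limit_imp_unif_conv cau) (auto simp: L_def)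
  then show False using nonconst[of "\<lambda>n. z (s n)"] by (simp add: G_def)
qed

section \<open>Lower and upper bounds for functions in \<open>class_N1\<close>\<close>

lemma normal_translates_sphere_val:
  assumes "normal_fun f"
  shows "normal_translates (sphere_val f)"
  using assms by (simp add: normal_fun_def normal_translates_def sphere_holomorphic_sphere_val)

lemma normal_translates_sinv:
  assumes "normal_translates F"
  shows "normal_translates (\<lambda>z. sinv (F z))"
  using assms
  by (simp add: normal_translates_def sphere_holomorphic_sinv unif_cauchy_compacta_def)

text \<open>The excluded constant limit used here is 0. The passage from chordal distance to modulus
  costs the factor 2 of \<open>chordal_le_norm\<close>.\<close>

lemma class_N1_bounded_below:
  assumes "class_N1 f" "\<delta> > 0"
  obtains c where "c > 0"
    "\<And>z. z \<notin> (\<Union>a\<in>zero_set f. ball a \<delta>) \<Longrightarrow> z \<notin> pole_set f \<Longrightarrow> c \<le> cmod (f z)"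
proof -
  have "normal_translates (sphere_val f)"
    using assms by (simp add: class_N1_def normal_translates_sphere_val)
  then obtain \<eta> where \<eta>: "\<eta> > 0" "\<And>z. (\<And>w. w \<in> ball z \<delta> \<Longrightarrow> sphere_val f w \<noteq> Some 0) \<Longrightarrow>
      \<eta> \<le> chordal (sphere_val f z) (Some 0)"
    by (rule bounded_away_from_zero[OF _ assms(2)]) (use assms(1) in \<open>auto simp: class_N1_def\<close>)
  have "\<eta> / 2 \<le> cmod (f z)" if "z \<notin> (\<Union>a\<in>zero_set f. ball a \<delta>)" "z \<notin> pole_set f" for z
  proof -
    have "\<eta> \<le> chordal (sphere_val f z) (Some 0)"
      using that(1) by (intro \<eta>(2)) (auto simp: sphere_val_def zero_set_def dist_commute)
    also have "\<dots> = chordal (Some (f z)) (Some 0)" using that(2) by (simp add: sphere_val_def)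
    also have "\<dots> \<le> 2 * cmod (f z - 0)" by (rule chordal_le_norm)
    finally show ?thesis by simp
  qed
  then show ?thesis using that \<eta>(1) by (meson half_gt_zero)
qed

text \<open>Poles of \<open>f\<close> are zeros of its inversion, and a limit 0 of inverted
  translates would be a limit \<open>None\<close> of translates of \<open>f\<close>. A chordal
  distance at least \<open>\<eta>\<close> from infinity means
  \<open>sqrt (1 + (cmod (f z))\<^sup>2) \<le> 2 / \<eta>\<close>.\<close>

lemma class_N1_bounded_above:
  assumes "class_N1 f" "\<delta> > 0"
  obtains C where "C > 0" "\<And>z. z \<notin> (\<Union>b\<in>pole_set f. ball b \<delta>) \<Longrightarrow> cmod (f z) \<le> C"
proof -
  have nt: "normal_translates (\<lambda>z. sinv (sphere_val f z))"
    using assms by (simp add: class_N1_def normal_translates_sphere_val normal_translates_sinv)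
  have nc: "\<not> unif_conv_compacta (\<lambda>n z. sinv (sphere_val f (z + h n))) (\<lambda>_. Some 0)" for h :: "nat \<Rightarrow> complex"
  proof
    assume "unif_conv_compacta (\<lambda>n z. sinv (sphere_val f (z + h n))) (\<lambda>_. Some 0)"
    then have "unif_conv_compacta (\<lambda>n z. sphere_val f (z + h n)) (\<lambda>_. None)"
      unfolding unif_conv_compacta_def by (metis chordal_sinv sinv.simps(1))
    with assms(1) show False by (auto simp: class_N1_def)
  qed
  obtain \<eta> where \<eta>: "\<eta> > 0" "\<And>z. (\<And>w. w \<in> ball z \<delta> \<Longrightarrow> sinv (sphere_val f w) \<noteq> Some 0) \<Longrightarrow>
      \<eta> \<le> chordal (sinv (sphere_val f z)) (Some 0)"
    by (rule bounded_away_from_zero[OF nt assms(2) nc]) auto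
  have "cmod (f z) \<le> 2 / \<eta>" if z: "z \<notin> (\<Union>b\<in>pole_set f. ball b \<delta>)" for z
  proof -
    have "z \<notin> pole_set f" using z assms(2) by auto
    have "\<eta> \<le> chordal (sinv (sphere_val f z)) (sinv None)"
      unfolding sinv.simps(1)
      using z by (intro \<eta>(2)) (auto simp: sphere_val_def dist_commute split: if_splits)
    also have "\<dots> = 2 / sqrt (1 + (cmod (f z))\<^sup>2)"
      unfolding chordal_sinv using \<open>z \<notin> pole_set f\<close> by (simp add: sphere_val_def)
    finally have "sqrt (1 + (cmod (f z))\<^sup>2) \<le> 2 / \<eta>"
      using \<eta>(1) by (simp add: field_simps add_pos_nonneg)
    moreover have "cmod (f z) \<le> sqrt (1 + (cmod (f z))\<^sup>2)"
      by (rule real_le_rsqrt) simp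
    ultimately show ?thesis by linarith
  qed
  then show ?thesis using that \<eta>(1) by (meson divide_pos_pos zero_less_numeral)
qed

section \<open>The common constant and the logarithmic derivative\<close>

theorem mainTheorem13:
  fixes f :: "complex \<Rightarrow> complex" and \<delta> :: real
  assumes "class_N1 f" and "\<delta> > 0"
  shows "\<exists>C C'. C > 0 \<and>
     (\<forall>z. z \<notin> (\<Union>b\<in>pole_set f. ball b \<delta>) \<longrightarrow> cmod (f z) \<le> C) \<and>
     (\<forall>z. z \<notin> (\<Union>a\<in>zero_set f. ball a \<delta>) \<and> z \<notin> pole_set f \<longrightarrow> cmod (f z) \<ge> 1 / C) \<and>
     (\<forall>z. z \<notin> (\<Union>a\<in>zero_set f. ball a \<delta>) \<union> (\<Union>b\<in>pole_set f. ball b \<delta>) \<longrightarrow>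
          cmod (deriv f z / f z) \<le> C')"
proof -
  obtain C1 where C1: "C1 > 0" "\<And>z. z \<notin> (\<Union>b\<in>pole_set f. ball b \<delta>) \<Longrightarrow> cmod (f z) \<le> C1"
    using class_N1_bounded_above[OF assms] by blast
  obtain c where c: "c > 0"
    "\<And>z. z \<notin> (\<Union>a\<in>zero_set f. ball a \<delta>) \<Longrightarrow> z \<notin> pole_set f \<Longrightarrow> c \<le> cmod (f z)"
    using class_N1_bounded_below[OF assms] by blast
  \<comment> \<open>Cauchy's inequality needs \<open>f\<close> bounded on a circle of radius
    \<open>\<delta>/2\<close> about \<open>z\<close>, whose points are only known to be at distance
    at least \<open>\<delta>/2\<close> from the poles.\<close>
  obtain C2 where C2: "C2 > 0" "\<And>z. z \<notin> (\<Union>b\<in>pole_set f. ball b (\<delta>/2)) \<Longrightarrow> cmod (f z) \<le> C2"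
    using class_N1_bounded_above[of f "\<delta>/2"] assms by auto
  \<comment> \<open>The maximum serves both bounds: \<open>C1 \<le> C\<close> and
    \<open>1 / C \<le> c\<close>.\<close>
  define C where "C = max C1 (1 / c)"
  have hol: "f holomorphic_on - pole_set f"
    using assms(1) by (simp add: class_N1_def normal_fun_def meromorphic_C_def)
  have "cmod (deriv f z / f z) \<le> (C2 / (\<delta>/2)) / c"
    if z: "z \<notin> (\<Union>a\<in>zero_set f. ball a \<delta>) \<union> (\<Union>b\<in>pole_set f. ball b \<delta>)" for z
  proof -
    have far: "w \<notin> (\<Union>b\<in>pole_set f. ball b (\<delta>/2))" if "w \<in> cball z (\<delta>/2)" for w
    proof
      assume "w \<in> (\<Union>b\<in>pole_set f. ball b (\<delta>/2))"
      then obtain b where "b \<in> pole_set f" "dist b w < \<delta>/2" by auto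
      moreover have "dist w z \<le> \<delta>/2" using that by (simp add: dist_commute)
      ultimately have "dist b z < \<delta>" using dist_triangle[of b z w] by linarith
      then show False using z \<open>b \<in> pole_set f\<close> by auto
    qed
    then have sub: "cball z (\<delta>/2) \<subseteq> - pole_set f" using assms(2) by force
    \<comment> \<open>Written as the case of order 1 to match the inequality for higher
      derivatives.\<close>
    have "cmod ((deriv ^^ 1) f z) \<le> fact 1 * C2 / (\<delta>/2) ^ 1"
    proof (rule Cauchy_inequality)
      show "f holomorphic_on ball z (\<delta>/2)"
        using hol sub ball_subset_cball by (blast intro: holomorphic_on_subset)
      show "continuous_on (cball z (\<delta>/2)) f"
        using holomorphic_on_subset[OF hol sub] by (rule holomorphic_on_imp_continuous_on)
      show "cmod (f x) \<le> C2" if "cmod (z - x) = \<delta>/2" for x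
        using that by (intro C2 far) (simp add: dist_norm)
    qed (use assms in simp)
    then have "cmod (deriv f z) \<le> C2 / (\<delta>/2)" by simp
    moreover have "c \<le> cmod (f z)"
      using z assms(2) by (intro c) auto
    ultimately show ?thesis
      unfolding norm_divide using c(1) C2(1) assms(2) by (intro frac_le) auto
  qed
  moreover have "1 / C \<le> c"
    using c(1) C1(1) by (simp add: C_def field_simps max_def)
  moreover have "C > 0" "C1 \<le> C" using C1(1) by (auto simp: C_def)
  ultimately show ?thesis
    using C1(2) c(2) by (intro exI[of _ C] exI[of _ "(C2 / (\<delta>/2)) / c"]) (auto intro: order_trans)
qed

end
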